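(* For every integer $n\ge 1$, $|\mathcal{S}_n(23;\,2\to 1)| = B_n$, where $B_n$ is the $n$-th Bell number.
   Context: $[n]=\{1,\dots,n\}$, and $\mathcal{S}_n$ is the set of permutations $\pi=\pi_1\pi_2\cdots\pi_n$ of $[n]$ in one-line notation. The permutation $\hat\pi$: for $\pi\in\mathcal{S}_n$, $\hat\pi\in\mathcal{S}_n$ is the permutation whose cycle form is obtained from the word $\pi_1\cdots\pi_n$ by inserting a left parenthesis before each left-to-right maximum (an entry larger than all entries to its left) and a right parenthesis immediately before the next left-to-right maximum, or at the end of the word. A cycle $(c_1,c_2,\dots,c_s)$ means $c_1\mapsto c_2\mapsto\cdots\mapsto c_s\mapsto c_1$. Example: if $\pi=2537164$ then $\hat\pi=(2)(53)(7164)$. Arrow patterns: an arrow pattern of size $k$ is a pair $(\nu;H)$ where $\nu=\nu_1\cdots\nu_m$ is a word of distinct positive integers, $H$ is a collection of arrows $b_i\to c_i$, and the set of all integers appearing in $\nu$ or $H$ is $[k]$. A permutation $\pi\in\mathcal{S}_n$ contains $(\nu;H)$ if there are a set $X=\{x_1<x_2<\cdots<x_k\}\subseteq[n]$ and indices $t_1<\cdots<t_m$ such that $\pi_{t_1}\pi_{t_2}\cdots\pi_{t_m}=x_{\nu_1}x_{\nu_2}\cdots x_{\nu_m}$ and $\hat\pi(x_{b_i})=x_{c_i}$ for every arrow $b_i\to c_i$ in $H$. Otherwise $\pi$ avoids $(\nu;H)$. $\mathcal{S}_n(\nu;H)$ is the set of permutations in $\mathcal{S}_n$ avoiding $(\nu;H)$.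 The Bell number $B_n$ is the number of set partitions of $[n]$. *)

theory Defs
  imports "HOL-Combinatorics.Combinatorics"
begin

text \<open>
  A permutation of \<open>{1..n}\<close> in one-line notation is a list in
  \<^term>\<open>permutations_of_set {1..n::nat}\<close>. List positions count from 0, the
  entries (and the letters of arrow patterns) from 1.
\<close>

definition ltr_max_at :: "nat list \<Rightarrow> nat \<Rightarrow> bool" where
  "ltr_max_at w i \<longleftrightarrow> i < length w \<and> (\<forall>j<i. w ! j < w ! i)"

text \<open>
  The first entry \<open>x\<close> of a block is larger than everything before it, so the next
  left-to-right maximum is the first later entry that is not smaller than \<open>x\<close>.
  The lemmas \<open>concat_ltr_blocks\<close>, \<open>Nil_notin_ltr_blocks\<close> and \<open>hd_ltr_blocks\<close>
  confirm that, for words with distinct entries, this cuts the word exactly at its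
  left-to-right maxima.
\<close>

function ltr_blocks :: "nat list \<Rightarrow> nat list list" where
  "ltr_blocks [] = []"
| "ltr_blocks (x # xs) =
     (x # takeWhile (\<lambda>y. y < x) xs) # ltr_blocks (dropWhile (\<lambda>y. y < x) xs)"
  by pat_completeness auto
termination
  by (relation "measure length") (auto simp: less_Suc_eq_le length_dropWhile_le)

text \<open>
  \<^term>\<open>cycle_of_list [c1, c2, c3]\<close> maps \<open>c1\<close> to \<open>c2\<close>, \<open>c2\<close> to \<open>c3\<close> and \<open>c3\<close> to
  \<open>c1\<close>. The blocks of a permutation are disjoint, so the order of composition
  is irrelevant.
\<close>

definition hat :: "nat list \<Rightarrow> nat \<Rightarrow> nat" where
  "hat w = foldr (\<circ>) (map cycle_of_list (ltr_blocks w)) id"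

type_synonym arrow_pattern = "nat list \<times> (nat \<times> nat) set"

definition letters :: "arrow_pattern \<Rightarrow> nat set" where
  "letters p = set (fst p) \<union> fst ` snd p \<union> snd ` snd p"

definition is_arrow_pattern :: "nat \<Rightarrow> arrow_pattern \<Rightarrow> bool" where
  "is_arrow_pattern k p \<longleftrightarrow> distinct (fst p) \<and> letters p = {1..k}"

text \<open>
  The set \<open>X = {x\<^sub>1 < \<dots> < x\<^sub>k}\<close> is given by its increasing enumeration \<open>x\<close>. For an arrow
  pattern of size \<open>k\<close>, \<^term>\<open>card (letters p)\<close> is \<open>k\<close>.
\<close>

definition contains_arrow :: "nat list \<Rightarrow> arrow_pattern \<Rightarrow> bool" where
  "contains_arrow w p \<longleftrightarrow>
     (let \<nu> = fst p; H = snd p; m = length \<nu>; k = card (letters p); n = length w in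
      \<exists>x t :: nat \<Rightarrow> nat.
        strict_mono_on {1..k} x \<and> x ` {1..k} \<subseteq> {1..n} \<and>
        strict_mono_on {..<m} t \<and> t ` {..<m} \<subseteq> {..<n} \<and>
        (\<forall>i<m. w ! t i = x (\<nu> ! i)) \<and>
        (\<forall>(b, c) \<in> H. hat w (x b) = x c))"

definition avoiders :: "nat \<Rightarrow> arrow_pattern \<Rightarrow> nat list set" where
  "avoiders n p = {w \<in> permutations_of_set {1..n}. \<not> contains_arrow w p}"

definition Bell :: "nat \<Rightarrow> nat" where
  "Bell n = card {P. partition_on {1..n} P}"

lemma is_arrow_pattern_23_21: "is_arrow_pattern 3 ([2, 3], {(2, 1)})"
  by (auto simp: is_arrow_pattern_def letters_def)

lemma ltr_blocks_example: "ltr_blocks [2, 5, 3, 7, 1, 6, 4] = [[2], [5, 3], [7, 1, 6, 4]]"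
  by simp

lemma hat_example: "map (hat [2, 5, 3, 7, 1, 6, 4]) [1..<8] = [6, 2, 5, 7, 3, 4, 1]"
  by (simp add: hat_def upt_rec transpose_def)

lemma concat_ltr_blocks: "concat (ltr_blocks w) = w"
  by (induction w rule: ltr_blocks.induct) auto

lemma Nil_notin_ltr_blocks: "[] \<notin> set (ltr_blocks w)"
  by (induction w rule: ltr_blocks.induct) auto

lemma hd_ltr_blocks:
  assumes "distinct w"
  shows "hd ` set (ltr_blocks w) = {w ! i |i. ltr_max_at w i}"
  using assms
proof (induction w rule: ltr_blocks.induct)
  case 1
  then show ?case by (auto simp: ltr_max_at_def)
next
  case (2 x xs)
  define a where "a = takeWhile (\<lambda>y. y < x) xs"
  define b where "b = dropWhile (\<lambda>y. y < x) xs"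
  have xs: "xs = a @ b" by (simp add: a_def b_def)
  have a_less: "y < x" if "y \<in> set a" for y
    using that by (auto simp: a_def dest: set_takeWhileD)
  have b_first: "x < b ! 0" if "b \<noteq> []"
  proof -
    have "\<not> hd b < x" using that hd_dropWhile[of "\<lambda>y. y < x" xs] by (simp add: b_def)
    moreover have "hd b \<noteq> x" using that "2.prems" xs by (cases b) auto
    ultimately show ?thesis using that by (simp add: hd_conv_nth)
  qed
  have IH: "hd ` set (ltr_blocks b) = {b ! i |i. ltr_max_at b i}"
  proof -
    have "distinct b" using "2.prems" xs by simp
    then show ?thesis using "2.IH" by (simp add: b_def)
  qed
  have shift: "ltr_max_at (x # xs) (Suc (length a + i)) \<longleftrightarrow> ltr_max_at b i" for i
  proof
    assume L: "ltr_max_at (x # xs) (Suc (length a + i))"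
    then have "i < length b" by (simp add: ltr_max_at_def xs)
    moreover have "b ! j < b ! i" if "j < i" for j
    proof -
      have "(x # xs) ! Suc (length a + j) < (x # xs) ! Suc (length a + i)"
        using L that unfolding ltr_max_at_def by (meson Suc_mono add_less_cancel_left)
      then show ?thesis by (simp add: xs)
    qed
    ultimately show "ltr_max_at b i" by (simp add: ltr_max_at_def)
  next
    assume R: "ltr_max_at b i"
    then have il: "i < length b" by (simp add: ltr_max_at_def)
    then have "b \<noteq> []" by auto
    have xb: "x < b ! i"
      using R b_first[OF \<open>b \<noteq> []\<close>] unfolding ltr_max_at_def
      by (metis less_trans neq0_conv)
    have "(x # xs) ! j < b ! i" if j: "j < Suc (length a + i)" for j
    proof (cases j)
      case 0
      then show ?thesis using xb by simp
    next
      case (Suc j')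
      show ?thesis
      proof (cases "j' < length a")
        case True
        then have "a ! j' < x" by (simp add: a_less)
        then show ?thesis using xb True Suc by (simp add: xs nth_append)
      next
        case False
        then have "j' - length a < i" using j Suc by simp
        then show ?thesis using R False Suc by (simp add: ltr_max_at_def xs nth_append)
      qed
    qed
    then show "ltr_max_at (x # xs) (Suc (length a + i))"
      using il by (simp add: ltr_max_at_def xs)
  qed
  have "{(x # xs) ! i |i. ltr_max_at (x # xs) i} = insert x {b ! i |i. ltr_max_at b i}"
  proof (intro equalityI subsetI)
    fix y assume "y \<in> {(x # xs) ! i |i. ltr_max_at (x # xs) i}"
    then obtain i where i: "y = (x # xs) ! i" "ltr_max_at (x # xs) i" by blast
    show "y \<in> insert x {b ! i |i. ltr_max_at b i}"
    proof (cases i)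
      case 0
      then show ?thesis using i by simp
    next
      case (Suc i')
      have "\<not> i' < length a"
      proof
        assume l: "i' < length a"
        then have "a ! i' < x" by (simp add: a_less)
        moreover have "x < (x # xs) ! i"
          using i Suc unfolding ltr_max_at_def by (metis nth_Cons_0 zero_less_Suc)
        ultimately show False using Suc l by (simp add: xs nth_append)
      qed
      then obtain l where l: "i' = length a + l" by (metis le_Suc_ex not_less)
      then show ?thesis using i shift[of l] Suc by (auto simp: xs)
    qed
  next
    fix y assume "y \<in> insert x {b ! i |i. ltr_max_at b i}"
    then consider "y = x" | l where "y = b ! l" "ltr_max_at b l" by blast
    then show "y \<in> {(x # xs) ! i |i. ltr_max_at (x # xs) i}"
    proof cases
      case 1
      then show ?thesis by (auto simp: ltr_max_at_def intro!: exI[of _ 0])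
    next
      case 2
      then show ?thesis using shift[of l] by (auto simp: xs intro!: exI[of _ "Suc (length a + l)"])
    qed
  qed
  then show ?case using IH by (simp add: a_def b_def)
qed

end

(* An arrow of the hat permutation descends exactly at the descents of the word, so the avoiders are
   the words in which every descent top exceeds all later entries. Such a word with maximum m has
   the form "increasing word, m, avoider", and the set before m is arbitrary: joined with m it acts
   as the block containing m of a set partition. Hence avoiders and set partitions satisfy the same
   recurrence. *)

theory Submission
  imports Defs
begin

section \<open>Arrows of the hat permutation\<close>

lemma hat_Cons:
  "hat (x # xs) = cycle_of_list (x # takeWhile (\<lambda>y. y < x) xs) \<circ> hat (dropWhile (\<lambda>y. y < x) xs)"
  by (simp add: hat_def)

text \<open>Needed in two ways: \<open>hat\<close> of a suffix fixes every letter outside that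
  suffix, and the head of an arrow is again an entry of the word.\<close>

lemma hat_permutes: "hat w permutes set w"
proof (induction w rule: ltr_blocks.induct)
  case 1
  show ?case by (simp add: hat_def permutes_id id_def[symmetric])
next
  case (2 x xs)
  let ?a = "takeWhile (\<lambda>y. y < x) xs" and ?b = "dropWhile (\<lambda>y. y < x) xs"
  have "set ?a \<union> set ?b = set xs"
    by (metis set_append takeWhile_dropWhile_id)
  then have "set (x # ?a) \<subseteq> set (x # xs)" "set ?b \<subseteq> set (x # xs)" by auto
  then show ?case
    unfolding hat_Cons
    using 2 cycle_permutes[of "x # ?a"] by (meson permutes_compose permutes_subset)
qed

text \<open>A cycle rotates its own list by one place. With the image written as an entry of
  \<open>a @ [x]\<close>, the wrap-around at the end of a block needs no separate case.\<close>

lemma cycle_of_list_nth: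
  assumes "distinct (x # a)" and "i \<le> length a"
  shows "cycle_of_list (x # a) ((x # a) ! i) = (a @ [x]) ! i"
proof -
  have "map (cycle_of_list (x # a)) (x # a) = a @ [x]"
    using cyclic_rotation[OF assms(1), of 1] by (simp del: cycle_of_list.simps)
  then show ?thesis
    using assms(2) by (metis length_Cons less_Suc_eq_le nth_map)
qed

text \<open>The cyclic arrow from the last entry of a block leads up to the maximum of the block,
  hence the descending arrows are exactly the descents of the word.\<close>

lemma hat_nth_less_iff:
  assumes "distinct w" and "i < length w"
  shows "hat w (w ! i) < w ! i \<longleftrightarrow> Suc i < length w \<and> w ! Suc i < w ! i"
  using assms
proof (induction w arbitrary: i rule: ltr_blocks.induct)
  case 1
  then show ?case by simp
next
  case (2 x xs)
  define a where "a = takeWhile (\<lambda>y. y < x) xs"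
  define b where "b = dropWhile (\<lambda>y. y < x) xs"
  have xs: "xs = a @ b" by (simp add: a_def b_def)
  have a_less: "\<forall>y\<in>set a. y < x"
    by (auto simp: a_def dest: set_takeWhileD)
  have b_first: "\<not> b ! 0 < x" if "b \<noteq> []"
    using that hd_dropWhile[of "\<lambda>y. y < x" xs] by (simp add: b_def hd_conv_nth)
  have dist: "distinct (x # a)" "distinct b" "set (x # a) \<inter> set b = {}"
    using 2(2) by (auto simp: xs)
  have hat: "hat (x # xs) y = cycle_of_list (x # a) (hat b y)" for y
    by (simp add: hat_Cons a_def b_def del: cycle_of_list.simps)
  show ?case
  proof (cases "i \<le> length a")
    case True
    then have eq: "(x # xs) ! i = (x # a) ! i"
      using nth_append[of "x # a" b i] by (simp add: xs)
    then have "(x # xs) ! i \<notin> set b"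
      using dist(3) True by (metis disjoint_iff length_Cons less_Suc_eq_le nth_mem)
    then have "hat (x # xs) ((x # xs) ! i) = (a @ [x]) ! i"
      using permutes_not_in[OF hat_permutes] cycle_of_list_nth[OF dist(1) True] eq
      by (simp add: hat del: cycle_of_list.simps)
    \<comment> \<open>This bound settles the last position of the block. There the arrow goes to
      \<open>x\<close>, hence does not descend, and the word either ends or continues with
      \<open>b ! 0\<close>, which is at least \<open>x\<close>. At earlier positions the arrow leads
      to the next entry.\<close>
    moreover have "(x # a) ! i \<le> x"
      using a_less True by (cases i) (auto intro!: less_imp_le)
    ultimately show ?thesis
      using True eq b_first by (cases "i = length a") (auto simp: xs nth_append)
  next
    case False
    then obtain j where j: "i = Suc (length a) + j"
      by (metis add_Suc less_eqE not_le Suc_le_eq)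
    then have nth: "(x # xs) ! i = b ! j" "(x # xs) ! Suc i = b ! Suc j" and jl: "j < length b"
      using 2(3) by (auto simp: xs nth_append)
    \<comment> \<open>The value stays in \<open>b\<close>, where the cycle of the first block acts
      as the identity.\<close>
    have "hat b (b ! j) \<in> set b"
      using jl permutes_in_image[OF hat_permutes, of b "b ! j"] by simp
    then have "hat (x # xs) (b ! j) = hat b (b ! j)"
      using dist by (metis hat id_outside_supp disjoint_iff)
    then show ?thesis
      using 2(1)[of j, folded b_def] dist(2) jl by (simp only: nth) (simp add: j xs)
  qed
qed

section \<open>Avoidance of a vincular pattern\<close>

text \<open>For distinct entries this is avoidance of the vincular pattern 21-3, whose first two
  letters must be adjacent. The recursive form suits inductions that peel off a prefix.\<close>

fun avoids_21_3 :: "nat list \<Rightarrow> bool" where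
  "avoids_21_3 (b # a # w) \<longleftrightarrow> (a < b \<longrightarrow> (\<forall>c\<in>set w. c \<le> b)) \<and> avoids_21_3 (a # w)"
| "avoids_21_3 _ \<longleftrightarrow> True"

lemma avoids_21_3_iff_nth:
  "avoids_21_3 w \<longleftrightarrow>
     (\<forall>i j. Suc i < j \<longrightarrow> j < length w \<longrightarrow> w ! Suc i < w ! i \<longrightarrow> w ! j \<le> w ! i)"
proof (induction w rule: avoids_21_3.induct)
  case (1 b a w)
  let ?P = "\<lambda>w i j. Suc i < j \<longrightarrow> j < length w \<longrightarrow> w ! Suc i < w ! i \<longrightarrow> w ! j \<le> w ! i"
  \<comment> \<open>Descents at position 0 are split off; those at later positions belong to the
    tail.\<close>
  have "(\<forall>i j. ?P (b # a # w) i j) \<longleftrightarrow>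
      (\<forall>j. ?P (b # a # w) 0 j) \<and> (\<forall>i j. ?P (b # a # w) (Suc i) j)"
  proof (intro iffI conjI allI)
    fix i j
    assume *: "(\<forall>j. ?P (b # a # w) 0 j) \<and> (\<forall>i j. ?P (b # a # w) (Suc i) j)"
    show "?P (b # a # w) i j"
    proof (cases i)
      case 0
      then show ?thesis using conjunct1[OF *, rule_format, of j] by blast
    next
      case (Suc i')
      then show ?thesis using conjunct2[OF *, rule_format, of i' j] by blast
    qed
  qed blast+
  also have "(\<forall>i j. ?P (b # a # w) (Suc i) j) \<longleftrightarrow> (\<forall>i j. ?P (a # w) i j)"
  proof (intro iffI allI)
    fix i j
    assume *: "\<forall>i j. ?P (b # a # w) (Suc i) j"
    show "?P (a # w) i j" using *[rule_format, of i "Suc j"] by auto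
  next
    fix i j
    assume *: "\<forall>i j. ?P (a # w) i j"
    show "?P (b # a # w) (Suc i) j" using *[rule_format, of i "j - 1"] by (cases j) auto
  qed
  also have "(\<forall>j. ?P (b # a # w) 0 j) \<longleftrightarrow> (a < b \<longrightarrow> (\<forall>c\<in>set w. c \<le> b))"
  proof
    assume *: "\<forall>j. ?P (b # a # w) 0 j"
    show "a < b \<longrightarrow> (\<forall>c\<in>set w. c \<le> b)"
    proof (intro impI ballI)
      fix c assume "a < b" "c \<in> set w"
      then obtain k where "k < length w" "c = w ! k" by (auto simp: in_set_conv_nth)
      then show "c \<le> b" using *[rule_format, of "Suc (Suc k)"] \<open>a < b\<close> by simp
    qed
  next
    assume *: "a < b \<longrightarrow> (\<forall>c\<in>set w. c \<le> b)"
    show "\<forall>j. ?P (b # a # w) 0 j"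
    proof (intro allI impI)
      fix j assume j: "Suc 0 < j" "j < length (b # a # w)" and "(b # a # w) ! Suc 0 < (b # a # w) ! 0"
      then obtain k where "j = Suc (Suc k)" by (metis less_imp_Suc_add add_Suc)
      then show "(b # a # w) ! j \<le> (b # a # w) ! 0" using j * \<open>_ < (b # a # w) ! 0\<close> by simp
    qed
  qed
  finally show ?case using "1.IH" by auto
qed auto

text \<open>An occurrence is determined by the positions \<open>i < j\<close> of the letters 2 and
  3, since the letter 1 must be the arrow's head. It therefore amounts to a descending arrow from an
  entry with a larger entry later, and descending arrows are descents.\<close>

lemma contains_arrow_23_21_iff:
  assumes w: "w \<in> permutations_of_set {1..n}"
  shows "contains_arrow w ([2, 3], {(2, 1)}) \<longleftrightarrow> \<not> avoids_21_3 w"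
proof -
  have len: "length w = n" and set: "set w = {1..n}" and dist: "distinct w"
    using w by (auto simp: permutations_of_set_def distinct_card[symmetric])
  have card: "card (letters ([2, 3], {(2, 1)})) = 3"
    using is_arrow_pattern_23_21 by (simp add: is_arrow_pattern_def)
  have k3: "{1..3::nat} = {1, 2, 3}" by auto
  have m2: "{..<2::nat} = {0, 1}" by auto
  have "contains_arrow w ([2, 3], {(2, 1)}) \<longleftrightarrow>
      (\<exists>i j. i < j \<and> j < n \<and> hat w (w ! i) < w ! i \<and> w ! i < w ! j)"
  proof
    assume "contains_arrow w ([2, 3], {(2, 1)})"
    then obtain x t :: "nat \<Rightarrow> nat" where
      x: "strict_mono_on {1..3} x" and t: "strict_mono_on {..<2} t" "t ` {..<2} \<subseteq> {..<n}"
      and wt: "\<forall>i<2. w ! t i = x ([2, 3] ! i)" and h: "hat w (x 2) = x 1"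
      unfolding contains_arrow_def Let_def card by (auto simp: len numeral_2_eq_2)
    have "x 1 < x 2" "x 2 < x 3" using x by (auto intro: strict_mono_onD)
    moreover have "t 0 < t 1" "t 1 < n"
      using t unfolding m2 by (auto simp: strict_mono_on_def)
    moreover have "w ! t 0 = x 2" "w ! t 1 = x 3" using wt by auto
    ultimately show "\<exists>i j. i < j \<and> j < n \<and> hat w (w ! i) < w ! i \<and> w ! i < w ! j"
      using h by metis
  next
    assume "\<exists>i j. i < j \<and> j < n \<and> hat w (w ! i) < w ! i \<and> w ! i < w ! j"
    then obtain i j where ij: "i < j" "j < n" "hat w (w ! i) < w ! i" "w ! i < w ! j" by blast
    \<comment> \<open>The values are prescribed by the arrow and the two positions; the last branch
      serves the argument 3.\<close>
    define x where "x = (\<lambda>l::nat. if l = 1 then hat w (w ! i) else if l = 2 then w ! i else w ! j)"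
    define t where "t = (\<lambda>l::nat. if l = 0 then i else j)"
    have mem: "w ! i \<in> set w" "w ! j \<in> set w" using ij by (auto simp: len)
    then have "hat w (w ! i) \<in> set w"
      by (simp add: permutes_in_image[OF hat_permutes])
    then have "x ` {1..3} \<subseteq> {1..n}" using mem unfolding set k3 by (auto simp: x_def)
    moreover have "strict_mono_on {1..3} x"
      unfolding k3 using ij by (auto simp: strict_mono_on_def x_def)
    moreover have "strict_mono_on {..<2} t" "t ` {..<2} \<subseteq> {..<n}"
      unfolding m2 using ij by (auto simp: strict_mono_on_def t_def)
    moreover have "\<forall>i<2. w ! t i = x ([2, 3] ! i)"
      by (auto simp: less_2_cases_iff t_def x_def)
    moreover have "hat w (x 2) = x 1" by (simp add: x_def)
    ultimately show "contains_arrow w ([2, 3], {(2, 1)})"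
      unfolding contains_arrow_def Let_def card by (auto simp: len numeral_2_eq_2)
  qed
  also have "\<dots> \<longleftrightarrow> (\<exists>i j. Suc i < j \<and> j < n \<and> w ! Suc i < w ! i \<and> w ! i < w ! j)"
  proof (intro ex_cong1 iffI; elim conjE)
    fix i j
    assume *: "i < j" "j < n" "hat w (w ! i) < w ! i" "w ! i < w ! j"
    then have "w ! Suc i < w ! i" using hat_nth_less_iff[OF dist, of i] len by simp
    \<comment> \<open>The entry after \<open>w ! i\<close> is smaller and \<open>w ! j\<close> is
      larger, so the letter 3 lies beyond the descent bottom.\<close>
    moreover have "Suc i \<noteq> j" using * calculation by auto
    ultimately show "Suc i < j \<and> j < n \<and> w ! Suc i < w ! i \<and> w ! i < w ! j" using * by simp
  next
    fix i j
    assume "Suc i < j" "j < n" "w ! Suc i < w ! i" "w ! i < w ! j"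
    then show "i < j \<and> j < n \<and> hat w (w ! i) < w ! i \<and> w ! i < w ! j"
      using hat_nth_less_iff[OF dist, of i] len by simp
  qed
  also have "\<dots> \<longleftrightarrow> \<not> avoids_21_3 w"
    unfolding avoids_21_3_iff_nth len by (meson not_le)
  finally show ?thesis .
qed

section \<open>Recurrence for avoiding words\<close>

text \<open>Any descent inside \<open>u\<close> is followed by the larger entry \<open>m\<close>, so
  \<open>u\<close> can have none. The step into \<open>m\<close> is an ascent, and a descent from
  \<open>m\<close> is harmless because nothing exceeds \<open>m\<close>; only the condition on
  \<open>v\<close> remains.\<close>

lemma avoids_21_3_max_append:
  assumes "\<forall>y\<in>set u \<union> set v. y < m"
  shows "avoids_21_3 (u @ m # v) \<longleftrightarrow> sorted u \<and> avoids_21_3 v"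
  using assms
proof (induction u rule: induct_list012)
  case 1
  then show ?case by (cases v) (auto intro: less_imp_le)
next
  case (2 x)
  then show ?case by (cases v) (auto intro: less_imp_le)
next
  case (3 x y u)
  have "\<not> (\<forall>c\<in>set (u @ m # v). c \<le> x)" "sorted (x # y # u) \<longleftrightarrow> x \<le> y \<and> sorted (y # u)"
    using "3.prems" by (auto simp: not_le)
  then show ?case using "3.IH"(2) "3.prems" by (auto simp: not_less)
qed

text \<open>Arbitrary ground sets are allowed because the recurrence removes arbitrary subsets,
  which leaves no interval in general.\<close>

definition avoiding_orders :: "nat set \<Rightarrow> nat list set" where
  "avoiding_orders S = {w \<in> permutations_of_set S. avoids_21_3 w}"

lemma finite_avoiding_orders: "finite (avoiding_orders S)"
  by (simp add: avoiding_orders_def)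

text \<open>\<open>T\<close> is the set of entries before the maximum; it has exactly one increasing
  order, so only the word after the maximum is left to choose.\<close>

lemma card_avoiding_orders_rec:
  assumes "finite S" and m: "m \<in> S" "\<forall>y\<in>S. y \<le> m"
  shows "card (avoiding_orders S) = (\<Sum>T\<in>Pow (S - {m}). card (avoiding_orders (S - {m} - T)))"
proof -
  let ?D = "SIGMA T:Pow (S - {m}). avoiding_orders (S - {m} - T)"
  let ?f = "\<lambda>(T, v). sorted_list_of_set T @ m # v"
  have fin: "finite T" if "T \<subseteq> S - {m}" for T
    using that assms(1) by (meson finite_Diff finite_subset)
  have less: "y < m" if "y \<in> S - {m}" for y
    using that m by (metis DiffE insertI1 le_neq_implies_less)
  have "inj_on ?f ?D"
  proof (rule inj_on_inverseI)
    fix p assume "p \<in> ?D"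
    then obtain T v where p: "p = (T, v)" and T: "T \<subseteq> S - {m}" by auto
    \<comment> \<open>The inverse cuts the word at \<open>m\<close>, which is not in
      \<open>T\<close>: the prefix gives back \<open>T\<close> and the part after \<open>m\<close>
      gives back \<open>v\<close>.\<close>
    then have "takeWhile (\<lambda>y. y \<noteq> m) (sorted_list_of_set T @ m # v) = sorted_list_of_set T"
      "dropWhile (\<lambda>y. y \<noteq> m) (sorted_list_of_set T @ m # v) = m # v"
      using fin[OF T] by (auto simp: takeWhile_append dropWhile_append)
    then show "(\<lambda>w. (set (takeWhile (\<lambda>y. y \<noteq> m) w), tl (dropWhile (\<lambda>y. y \<noteq> m) w))) (?f p) = p"
      using fin[OF T] by (simp add: p)
  qed
  moreover have "?f ` ?D = avoiding_orders S"
  proof (intro equalityI subsetI)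
    fix w assume "w \<in> ?f ` ?D"
    then obtain T v where T: "T \<subseteq> S - {m}" and v: "v \<in> avoiding_orders (S - {m} - T)"
      and w: "w = sorted_list_of_set T @ m # v" by auto
    have "set v = S - {m} - T" "distinct v" "avoids_21_3 v"
      using v by (auto simp: avoiding_orders_def permutations_of_set_def)
    then show "w \<in> avoiding_orders S"
      using T fin[OF T] m(1) less avoids_21_3_max_append[of "sorted_list_of_set T" v m]
      by (auto simp: w avoiding_orders_def permutations_of_set_def)
  next
    fix w assume "w \<in> avoiding_orders S"
    then have w: "set w = S" "distinct w" "avoids_21_3 w"
      by (auto simp: avoiding_orders_def permutations_of_set_def)
    then obtain u v where uv: "w = u @ m # v" using m(1) by (metis split_list)
    have uv_avoids: "sorted u" "avoids_21_3 v"
      using avoids_21_3_max_append[of u v m] less w uv by auto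
    \<comment> \<open>A sorted word with distinct entries is recovered from its set.\<close>
    then have "w = ?f (set u, v)"
      using w uv by (simp add: sorted_list_of_set.idem_if_sorted_distinct)
    moreover have "(set u, v) \<in> ?D"
      using w uv uv_avoids by (auto simp: avoiding_orders_def permutations_of_set_def)
    ultimately show "w \<in> ?f ` ?D" by blast
  qed
  ultimately have "bij_betw ?f ?D (avoiding_orders S)"
    by (simp add: bij_betw_def)
  then have "card (avoiding_orders S) = card ?D" by (metis bij_betw_same_card)
  also have "\<dots> = (\<Sum>T\<in>Pow (S - {m}). card (avoiding_orders (S - {m} - T)))"
    using assms(1) by (simp add: finite_avoiding_orders)
  finally show ?thesis .
qed

section \<open>Recurrence for set partitions\<close>

text \<open>Here \<open>insert m T\<close> is the block of \<open>m\<close>, and the other blocks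
  partition what is left.\<close>

lemma card_partition_on_rec:
  assumes "finite S" and m: "m \<in> S"
  shows "card {P. partition_on S P} =
    (\<Sum>T\<in>Pow (S - {m}). card {P. partition_on (S - {m} - T) P})"
proof -
  let ?D = "SIGMA T:Pow (S - {m}). {P. partition_on (S - {m} - T) P}"
  let ?f = "\<lambda>(T, P). insert (insert m T) P"
  have notin: "m \<notin> B" if "partition_on (S - {m} - T) P" "B \<in> P" for T P B
    using that by (auto simp: partition_on_def)
  have "inj_on ?f ?D"
  proof (rule inj_on_inverseI)
    fix p assume "p \<in> ?D"
    then obtain T P where p: "p = (T, P)" and T: "m \<notin> T" and P: "partition_on (S - {m} - T) P"
      by auto
    \<comment> \<open>No block of \<open>P\<close> contains \<open>m\<close>, so membership of
      \<open>m\<close> singles out the added block.\<close>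
    then have "{B \<in> ?f p. m \<in> B} = {insert m T}" "{B \<in> ?f p. m \<notin> B} = P"
      using notin[OF P] by auto
    then show "(\<lambda>Q. (the_elem {B \<in> Q. m \<in> B} - {m}, {B \<in> Q. m \<notin> B})) (?f p) = p"
      using T by (simp add: p)
  qed
  moreover have "?f ` ?D = {P. partition_on S P}"
  proof (intro equalityI subsetI)
    fix Q assume "Q \<in> ?f ` ?D"
    then obtain T P where T: "T \<subseteq> S - {m}" and P: "partition_on (S - {m} - T) P"
      and Q: "Q = insert (insert m T) P" by auto
    have "disjnt (insert m T) (\<Union>P)"
      using partition_onD1[OF P] by (auto simp: disjnt_def)
    moreover have "S - {m} - T = S - insert m T" by auto
    ultimately show "Q \<in> {P. partition_on S P}"
      using T P m by (auto simp: Q partition_on_insert)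
  next
    fix Q assume "Q \<in> {P. partition_on S P}"
    then have Q: "partition_on S Q" by simp
    then obtain B where B: "B \<in> Q" "m \<in> B" using m by (auto simp: partition_on_def)
    have "disjnt B (\<Union>(Q - {B}))"
      using partition_onD2[OF Q] B(1) by (auto simp: disjoint_def disjnt_def)
    \<comment> \<open>\<open>partition_on_insert\<close> is read backwards, with \<open>Q\<close> as
      \<open>insert B (Q - {B})\<close>.\<close>
    then have "partition_on (S - B) (Q - {B})" "B \<subseteq> S"
      using partition_on_insert[of B "Q - {B}" S] Q B(1) by (auto simp: insert_absorb)
    moreover have "S - {m} - (B - {m}) = S - B" using B by auto
    ultimately have "(B - {m}, Q - {B}) \<in> ?D" by auto
    moreover have "Q = ?f (B - {m}, Q - {B})" using B by (auto simp: insert_absorb)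
    ultimately show "Q \<in> ?f ` ?D" by blast
  qed
  ultimately have "bij_betw ?f ?D {P. partition_on S P}"
    by (simp add: bij_betw_def)
  then have "card {P. partition_on S P} = card ?D" by (metis bij_betw_same_card)
  also have "\<dots> = (\<Sum>T\<in>Pow (S - {m}). card {P. partition_on (S - {m} - T) P})"
    using assms(1) by (simp add: finitely_many_partition_on)
  finally show ?thesis .
qed

section \<open>Comparison of the two counts\<close>

text \<open>Strong induction on the set: with \<open>m = Max S\<close> both recurrences run over the
  same subsets \<open>T\<close>, and each remaining set is a proper subset of
  \<open>S\<close>.\<close>

lemma card_avoiding_orders:
  assumes "finite S"
  shows "card (avoiding_orders S) = card {P. partition_on S P}"
  using assms
proof (induction S rule: finite_psubset_induct)
  case (psubset S)
  show ?case
  proof (cases "S = {}")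
    case True
    then show ?thesis
      by (simp add: avoiding_orders_def partition_on_empty conj_commute cong: conj_cong)
  next
    case False
    then have "Max S \<in> S" "\<forall>y\<in>S. y \<le> Max S" using psubset.hyps by auto
    moreover have "card (avoiding_orders (S - {Max S} - T)) =
        card {P. partition_on (S - {Max S} - T) P}" for T
      using \<open>Max S \<in> S\<close> by (intro psubset.IH) auto
    ultimately show ?thesis
      using psubset.hyps by (simp add: card_avoiding_orders_rec card_partition_on_rec)
  qed
qed

theorem theorem5p1:
  fixes n :: nat
  assumes "n \<ge> 1"
  shows "card (avoiders n ([2, 3], {(2, 1)})) = Bell n"
proof -
  have "avoiders n ([2, 3], {(2, 1)}) = avoiding_orders {1..n}"
    unfolding avoiders_def avoiding_orders_def using contains_arrow_23_21_iff by blast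
  then show ?thesis by (simp add: Bell_def card_avoiding_orders)
qed

end
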